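(* Let $R$ be a finite non-commutative ring with $1\neq 0$, let $k\ge 1$, and let $R_k=R[\beta_1,\ldots,\beta_k]$ be the ring of dual numbers in $k$ variables over $R$. Then: (1) $N_{R_k}=AN_R+\sum_{i=1}^{k}N_R\,\beta_i$; (2) $N_{R_k}$ is a (two-sided) ideal of $R_k[x]$ if and only if $AN_R$ and $N_R$ are both (two-sided) ideals of $R[x]$.
   Context: Rings are associative with identity $1\ne 0$. In a polynomial ring $A[x]$ the variable $x$ commutes with the coefficients. For $f=\sum_{i=0}^n a_ix^i\in A[x]$ and $b\in A$, put $f(b)=\sum_{i=0}^n a_ib^i$ (right substitution). $R_k=R[\beta_1,\ldots,\beta_k]$ is the quotient $R[x_1,\ldots,x_k]/T$, where $T$ is the ideal generated by all $x_ix_j$ ($1\le i,j\le k$) and $\beta_i=x_i+T$. It is the free $R$-algebra with basis $1,\beta_1,\ldots,\beta_k$, with $\beta_i$ central and $\beta_i\beta_j=0$ for all $1\le i,j\le k$. Every $f\in R_k[x]$ is uniquely $f=f_0+\sum_{i=1}^k f_i\beta_i$ with $f_0,\ldots,f_k\in R[x]$. For a ring $A$, $N_A=\{f\in A[x]\mid f(a)=0 \text{ for all } a\in A\}$ is the set of null polynomials on $A$ (always a left ideal of $A[x]$). For $f=\sum_{j=0}^n a_jx^j\in R[x]$, the assigned polynomial in non-commuting variables $y,z$ is $\lambda_f(y,z)=\sum_{j=1}^n\sum_{r=1}^j a_j y^{r-1}zy^{j-r}$; for $a,b\in R$, $\lambda_f(a,b)=\sum_{j=1}^n\sum_{r=1}^j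 a_ja^{r-1}ba^{j-r}$. $AN_R=\{f\in N_R\mid \lambda_f(a,b)=0\text{ for all }a,b\in R\}$ (a left ideal of $R[x]$). *)

theory Defs
  imports "HOL.Hull" "HOL-Library.Poly_Mapping"
begin

text \<open>
  Rings are types of class \<^class>\<open>ring_1\<close>, which are not assumed commutative and satisfy
  \<open>0 \<noteq> 1\<close>. Polynomials are the finitely supported coefficient functions of
  \<^theory>\<open>HOL-Library.Poly_Mapping\<close> with convolution product, since \<open>'a poly\<close> is only a ring over
  commutative coefficients: \<open>nat \<Rightarrow>\<^sub>0 'a\<close> is the univariate polynomial ring and
  \<open>('k \<Rightarrow>\<^sub>0 nat) \<Rightarrow>\<^sub>0 'a\<close> is the polynomial ring in the commuting variables indexed by \<open>'k\<close>.
  In both, the variables commute with the coefficients.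
\<close>

definition left_ideal :: "'a::ring_1 set \<Rightarrow> bool" where
  "left_ideal I \<longleftrightarrow> 0 \<in> I \<and> (\<forall>a\<in>I. \<forall>b\<in>I. a - b \<in> I) \<and> (\<forall>r. \<forall>a\<in>I. r * a \<in> I)"

definition two_sided_ideal :: "'a::ring_1 set \<Rightarrow> bool" where
  "two_sided_ideal I \<longleftrightarrow> left_ideal I \<and> (\<forall>a\<in>I. \<forall>r. a * r \<in> I)"

lemma two_sided_ideal_hull: "two_sided_ideal (two_sided_ideal hull S)"
  by (rule hull_in) (auto simp: two_sided_ideal_def left_ideal_def)

lemma two_sided_idealD:
  assumes "two_sided_ideal I"
  shows "0 \<in> I"
    and "a \<in> I \<Longrightarrow> b \<in> I \<Longrightarrow> a - b \<in> I"
    and "a \<in> I \<Longrightarrow> - a \<in> I"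
    and "a \<in> I \<Longrightarrow> b \<in> I \<Longrightarrow> a + b \<in> I"
    and "a \<in> I \<Longrightarrow> r * a \<in> I"
    and "a \<in> I \<Longrightarrow> a * r \<in> I"
proof -
  show *: "0 \<in> I" "\<And>a b. a \<in> I \<Longrightarrow> b \<in> I \<Longrightarrow> a - b \<in> I"
    "a \<in> I \<Longrightarrow> r * a \<in> I" "a \<in> I \<Longrightarrow> a * r \<in> I"
    using assms by (auto simp: two_sided_ideal_def left_ideal_def)
  show minus: "- a \<in> I" if "a \<in> I" for a
    using *(2)[OF *(1) that] by simp
  show "a \<in> I \<Longrightarrow> b \<in> I \<Longrightarrow> a + b \<in> I"
    using *(2)[of a "- b"] minus[of b] by simp
qed


section \<open>Rings of dual numbers\<close>

definition mvar :: "'k \<Rightarrow> (('k \<Rightarrow>\<^sub>0 nat) \<Rightarrow>\<^sub>0 'a::ring_1)" where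
  "mvar i = Poly_Mapping.single (Poly_Mapping.single i 1) 1"

definition dual_ideal :: "(('k \<Rightarrow>\<^sub>0 nat) \<Rightarrow>\<^sub>0 'a::ring_1) set" where
  "dual_ideal = two_sided_ideal hull {mvar i * mvar j | i j. True}"

lemma dual_ideal: "two_sided_ideal dual_ideal"
  unfolding dual_ideal_def by (rule two_sided_ideal_hull)

lemma mvar_mult_mvar_in_dual_ideal: "mvar i * mvar j \<in> dual_ideal"
  unfolding dual_ideal_def by (rule hull_inc) blast

lemma lookup_mult_zero:
  fixes p q :: "('k \<Rightarrow>\<^sub>0 nat) \<Rightarrow>\<^sub>0 'a::ring_1"
  shows "Poly_Mapping.lookup (p * q) 0 = Poly_Mapping.lookup p 0 * Poly_Mapping.lookup q 0"
proof -
  have *: "0 = l + m \<longleftrightarrow> l = 0 \<and> m = 0" for l m :: "'k \<Rightarrow>\<^sub>0 nat"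
    by (auto simp: poly_mapping_eq_iff fun_eq_iff lookup_add)
  have **: "(\<Sum>m. Poly_Mapping.lookup q m when 0 = l + m) = (Poly_Mapping.lookup q 0 when l = 0)" for l
  proof -
    have "(\<Sum>m. Poly_Mapping.lookup q m when 0 = l + m) = (\<Sum>m. (Poly_Mapping.lookup q m when l = 0) when m = 0)"
      by (rule arg_cong[where f = Sum_any]) (auto simp: * when_def)
    then show ?thesis by simp
  qed
  show ?thesis
    unfolding lookup_mult ** by (simp add: mult_when)
qed

lemma one_notin_dual_ideal: "1 \<notin> (dual_ideal :: (('k \<Rightarrow>\<^sub>0 nat) \<Rightarrow>\<^sub>0 'a::ring_1) set)"
proof -
  let ?I = "{p :: ('k \<Rightarrow>\<^sub>0 nat) \<Rightarrow>\<^sub>0 'a. Poly_Mapping.lookup p 0 = 0}"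
  have "two_sided_ideal ?I"
    by (auto simp: two_sided_ideal_def left_ideal_def lookup_minus lookup_mult_zero)
  moreover have "Poly_Mapping.lookup (mvar i :: ('k \<Rightarrow>\<^sub>0 nat) \<Rightarrow>\<^sub>0 'a) 0 = 0" for i :: 'k
    by (auto simp: mvar_def lookup_single when_def poly_mapping_eq_iff fun_eq_iff)
  then have "{mvar i * mvar j | i j. True} \<subseteq> ?I"
    by (auto simp: lookup_mult_zero)
  ultimately have "dual_ideal \<subseteq> ?I"
    unfolding dual_ideal_def by (intro hull_minimal) auto
  then show ?thesis by auto
qed

text \<open>
  The ring \<open>R\<^sub>k\<close> for a ring \<open>R = 'a\<close> and \<open>k = CARD('k)\<close> variables.
\<close>

quotient_type (overloaded) ('a, 'k) dual = "('k \<Rightarrow>\<^sub>0 nat) \<Rightarrow>\<^sub>0 'a::ring_1" /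
  "\<lambda>p q. p - q \<in> dual_ideal"
proof (rule equivpI)
  note I = two_sided_idealD[OF dual_ideal]
  show "reflp (\<lambda>p q. p - q \<in> dual_ideal)"
    by (auto intro!: reflpI I(1))
  show "symp (\<lambda>p q. p - q \<in> dual_ideal)"
    by (rule sympI) (use I(3) in fastforce)
  show "transp (\<lambda>p q. p - q \<in> dual_ideal)"
    by (rule transpI) (use I(4) in fastforce)
qed

instantiation dual :: (ring_1, type) ring_1
begin

lift_definition zero_dual :: "('a, 'k) dual" is 0 .

lift_definition one_dual :: "('a, 'k) dual" is 1 .

lift_definition plus_dual :: "('a, 'k) dual \<Rightarrow> ('a, 'k) dual \<Rightarrow> ('a, 'k) dual" is "(+)"
proof -
  fix p p' q q' :: "('k \<Rightarrow>\<^sub>0 nat) \<Rightarrow>\<^sub>0 'a"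
  assume *: "p - p' \<in> dual_ideal" "q - q' \<in> dual_ideal"
  have "p + q - (p' + q') = (p - p') + (q - q')"
    by (simp add: algebra_simps)
  then show "p + q - (p' + q') \<in> dual_ideal"
    using * two_sided_idealD(4)[OF dual_ideal] by metis
qed

lift_definition uminus_dual :: "('a, 'k) dual \<Rightarrow> ('a, 'k) dual" is uminus
proof -
  fix p p' :: "('k \<Rightarrow>\<^sub>0 nat) \<Rightarrow>\<^sub>0 'a"
  assume *: "p - p' \<in> dual_ideal"
  have "- p - - p' = - (p - p')"
    by simp
  then show "- p - - p' \<in> dual_ideal"
    using * two_sided_idealD(3)[OF dual_ideal] by metis
qed

lift_definition minus_dual :: "('a, 'k) dual \<Rightarrow> ('a, 'k) dual \<Rightarrow> ('a, 'k) dual" is "(-)"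
proof -
  fix p p' q q' :: "('k \<Rightarrow>\<^sub>0 nat) \<Rightarrow>\<^sub>0 'a"
  assume *: "p - p' \<in> dual_ideal" "q - q' \<in> dual_ideal"
  have "p - q - (p' - q') = (p - p') - (q - q')"
    by (simp add: algebra_simps)
  then show "p - q - (p' - q') \<in> dual_ideal"
    using * two_sided_idealD(2)[OF dual_ideal] by metis
qed

lift_definition times_dual :: "('a, 'k) dual \<Rightarrow> ('a, 'k) dual \<Rightarrow> ('a, 'k) dual" is "(*)"
proof -
  fix p p' q q' :: "('k \<Rightarrow>\<^sub>0 nat) \<Rightarrow>\<^sub>0 'a"
  assume *: "p - p' \<in> dual_ideal" "q - q' \<in> dual_ideal"
  have "p * q - p' * q' = (p - p') * q + p' * (q - q')"
    by (simp add: algebra_simps)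
  then show "p * q - p' * q' \<in> dual_ideal"
    using * two_sided_idealD[OF dual_ideal] by metis
qed

instance
proof
  note zero = two_sided_idealD(1)[OF dual_ideal]
  fix a b c :: "('a, 'k) dual"
  show "a + b + c = a + (b + c)" "a + b = b + a" "0 + a = a" "- a + a = 0" "a - b = a + - b"
    "a * b * c = a * (b * c)" "1 * a = a" "a * 1 = a"
    "(a + b) * c = a * c + b * c" "a * (b + c) = a * b + a * c"
    by (transfer; simp add: zero algebra_simps)+
  show "(0 :: ('a, 'k) dual) \<noteq> 1"
    by transfer (use one_notin_dual_ideal two_sided_idealD(3)[OF dual_ideal] in fastforce)
qed

end

lift_definition dual_const :: "'a::ring_1 \<Rightarrow> ('a, 'k) dual" is "Poly_Mapping.single 0" .

lift_definition dual_beta :: "'k \<Rightarrow> ('a::ring_1, 'k) dual" is mvar .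


section \<open>Null polynomials\<close>

definition right_eval :: "(nat \<Rightarrow>\<^sub>0 'a::ring_1) \<Rightarrow> 'a \<Rightarrow> 'a" where
  "right_eval f b = (\<Sum>i\<in>Poly_Mapping.keys f. Poly_Mapping.lookup f i * b ^ i)"

definition null_polys :: "(nat \<Rightarrow>\<^sub>0 'a::ring_1) set" where
  "null_polys = {f. \<forall>a. right_eval f a = 0}"

text \<open>
  The assigned polynomial \<open>\<lambda>\<^sub>f(y, z)\<close> is only ever used through its values \<open>\<lambda>\<^sub>f(a, b)\<close>.
\<close>

definition assigned_eval :: "(nat \<Rightarrow>\<^sub>0 'a::ring_1) \<Rightarrow> 'a \<Rightarrow> 'a \<Rightarrow> 'a" where
  "assigned_eval f a b = (\<Sum>j\<in>Poly_Mapping.keys f. \<Sum>r = 1..j. Poly_Mapping.lookup f j * a ^ (r - 1) * b * a ^ (j - r))"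

definition assigned_null_polys :: "(nat \<Rightarrow>\<^sub>0 'a::ring_1) set" where
  "assigned_null_polys = {f \<in> null_polys. \<forall>a b. assigned_eval f a b = 0}"

text \<open>
  The inclusion of \<open>R[x]\<close> in \<open>R\<^sub>k[x]\<close>, and \<open>\<beta>\<^sub>i\<close> as a constant of \<open>R\<^sub>k[x]\<close>.
\<close>

definition dual_poly :: "(nat \<Rightarrow>\<^sub>0 'a::ring_1) \<Rightarrow> (nat \<Rightarrow>\<^sub>0 ('a, 'k) dual)" where
  "dual_poly f = Poly_Mapping.map dual_const f"

definition beta_poly :: "'k \<Rightarrow> (nat \<Rightarrow>\<^sub>0 ('a::ring_1, 'k) dual)" where
  "beta_poly i = Poly_Mapping.single 0 (dual_beta i)"

end

(* Every element of R_k has unique coordinates (a, b_1, ..., b_k), and (a + sum b_i beta_i)^j has beta_i-coordinate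
   sum_r a^(r-1) b_i a^(j-r). Hence f = f_0 + sum f_i beta_i takes at a + sum b_i beta_i the value
   f_0(a) + sum_i (lambda_{f_0}(a, b_i) + f_i(a)) beta_i. Putting b_i = 0 shows that f is null iff f_0 lies in AN_R and all
   f_i lie in N_R. The second part follows since f_0 depends multiplicatively on f and f_i is a derivation over it. *)

theory Submission
  imports Defs
begin

section \<open>Finitely supported functions\<close>

text \<open>Updating a fresh key adds a monomial, so an additive property need only be checked on
  monomials. Product formulas below are proved this way, one monomial factor at a time, instead of
  by computing with convolutions.\<close>

lemma poly_mapping_add_induct [case_names single add]:
  fixes p :: "'k \<Rightarrow>\<^sub>0 'b::comm_monoid_add"
  assumes "\<And>k c. P (Poly_Mapping.single k c)"
    and "\<And>p q. P p \<Longrightarrow> P q \<Longrightarrow> P (p + q)"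
  shows "P p"
proof (induction p rule: update_induct)
  case const
  \<comment> \<open>A monomial with coefficient 0 at any key is the zero function, so empty support
    falls under the monomial case.\<close>
  show ?case using assms(1)[of undefined 0] by simp
next
  case (update f a b)
  have "Poly_Mapping.update a b f = Poly_Mapping.single a b + f"
    using update(1)
    by (intro poly_mapping_eqI) (auto simp: lookup_update lookup_add lookup_single when_def in_keys_iff)
  then show ?case using assms update by simp
qed

text \<open>\<open>Poly_Mapping.map\<close> applies \<open>h\<close> only on the support;
  \<open>h 0 = 0\<close> makes this agree with \<open>h\<close> everywhere.\<close>

lemma lookup_map:
  "h 0 = 0 \<Longrightarrow> Poly_Mapping.lookup (Poly_Mapping.map h f) k = h (Poly_Mapping.lookup f k)"
  by (simp add: map.rep_eq when_def)

lemma map_add_additive: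
  assumes "\<And>x y. h (x + y) = h x + h y" and "h 0 = 0"
  shows "Poly_Mapping.map h (f + g) = Poly_Mapping.map h f + Poly_Mapping.map h g"
  using assms by (intro poly_mapping_eqI) (simp add: lookup_map lookup_add)

section \<open>Coordinates on the ring of dual numbers\<close>

lemma add_eq_zero_poly_mapping_nat_iff:
  fixes l m :: "'k \<Rightarrow>\<^sub>0 nat"
  shows "l + m = 0 \<longleftrightarrow> l = 0 \<and> m = 0"
  by (auto simp: poly_mapping_eq_iff fun_eq_iff lookup_add)

text \<open>Subtraction of exponents is truncated; a positive exponent at \<open>i\<close> makes it
  exact.\<close>

lemma single_add_diff:
  fixes m :: "'k \<Rightarrow>\<^sub>0 nat"
  assumes "Poly_Mapping.lookup m i \<noteq> 0"
  shows "m = Poly_Mapping.single i 1 + (m - Poly_Mapping.single i 1)"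
  using assms by (intro poly_mapping_eqI) (auto simp: lookup_add lookup_minus lookup_single when_def)

lemma nonzero_monomial_cases:
  fixes m :: "'k \<Rightarrow>\<^sub>0 nat"
  assumes "m \<noteq> 0"
  obtains i m' where "m = Poly_Mapping.single i 1 + m'"
proof -
  obtain i where "Poly_Mapping.lookup m i \<noteq> 0"
    using assms by (auto simp: poly_mapping_eq_iff fun_eq_iff)
  then show ?thesis by (rule that[OF single_add_diff])
qed

lemma single_neq_zero [simp]: "Poly_Mapping.single (i::'k) (1::nat) \<noteq> 0"
  using lookup_single_eq[of i "1::nat"] by (auto simp del: lookup_single_eq)

text \<open>One of the two monomials has a positive exponent at \<open>i\<close>; cancelling the
  variable there leaves two exponent vectors with sum 0, so both vanish.\<close>

lemma add_eq_single_one_iff: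
  fixes l m :: "'k \<Rightarrow>\<^sub>0 nat"
  shows "l + m = Poly_Mapping.single i 1 \<longleftrightarrow>
    l = 0 \<and> m = Poly_Mapping.single i 1 \<or> l = Poly_Mapping.single i 1 \<and> m = 0"
proof
  assume *: "l + m = Poly_Mapping.single i 1"
  then have "Poly_Mapping.lookup l i + Poly_Mapping.lookup m i = 1"
    by (metis lookup_add lookup_single_eq)
  then consider "Poly_Mapping.lookup l i \<noteq> 0" | "Poly_Mapping.lookup m i \<noteq> 0"
    by fastforce
  then show "l = 0 \<and> m = Poly_Mapping.single i 1 \<or> l = Poly_Mapping.single i 1 \<and> m = 0"
  proof cases
    case 1
    from single_add_diff[OF 1] *
    have "Poly_Mapping.single i 1 + ((l - Poly_Mapping.single i 1) + m) = Poly_Mapping.single i 1 + 0"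
      by (metis add.assoc add.right_neutral)
    then have "(l - Poly_Mapping.single i 1) + m = 0"
      by (rule add_left_imp_eq)
    then show ?thesis
      using single_add_diff[OF 1] by (metis add.right_neutral add_eq_zero_poly_mapping_nat_iff)
  next
    case 2
    from single_add_diff[OF 2] *
    have "Poly_Mapping.single i 1 + (l + (m - Poly_Mapping.single i 1)) = Poly_Mapping.single i 1 + 0"
      by (metis add.left_commute add.right_neutral)
    then have "l + (m - Poly_Mapping.single i 1) = 0"
      by (rule add_left_imp_eq)
    then show ?thesis
      using single_add_diff[OF 2] by (metis add.right_neutral add_eq_zero_poly_mapping_nat_iff)
  qed
qed auto

text \<open>Both sides are biadditive, and for monomials \<open>add_eq_single_one_iff\<close> lists
  the two ways to obtain a single variable. This is the source of all Leibniz rules below.\<close>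

lemma lookup_mult_single_one:
  fixes p q :: "('k \<Rightarrow>\<^sub>0 nat) \<Rightarrow>\<^sub>0 'a::ring_1"
  shows "Poly_Mapping.lookup (p * q) (Poly_Mapping.single i 1) =
    Poly_Mapping.lookup p 0 * Poly_Mapping.lookup q (Poly_Mapping.single i 1) +
    Poly_Mapping.lookup p (Poly_Mapping.single i 1) * Poly_Mapping.lookup q 0"
proof (induction p rule: poly_mapping_add_induct)
  case (single l a)
  show ?case
  proof (induction q rule: poly_mapping_add_induct)
    case (single m b)
    show ?case
      using single_neq_zero[of i]
      by (auto simp: mult_single lookup_single when_def add_eq_single_one_iff simp del: One_nat_def)
  next
    case (add p q)
    then show ?case by (simp add: lookup_add algebra_simps)
  qed
next
  case (add p q)
  then show ?case by (simp add: lookup_add algebra_simps)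
qed

text \<open>Polynomials without terms of degree 0 and 1 form an ideal that contains the generators.
  Conversely, a monomial of degree at least 2 is a multiple of a product of two variables. Hence the
  coefficients of degree at most 1 are well-defined coordinates on the quotient and separate its
  elements.\<close>

lemma dual_ideal_iff:
  fixes p :: "('k \<Rightarrow>\<^sub>0 nat) \<Rightarrow>\<^sub>0 'a::ring_1"
  shows "p \<in> dual_ideal \<longleftrightarrow>
    Poly_Mapping.lookup p 0 = 0 \<and> (\<forall>i. Poly_Mapping.lookup p (Poly_Mapping.single i 1) = 0)"
proof
  let ?J = "{p :: ('k \<Rightarrow>\<^sub>0 nat) \<Rightarrow>\<^sub>0 'a.
    Poly_Mapping.lookup p 0 = 0 \<and> (\<forall>i. Poly_Mapping.lookup p (Poly_Mapping.single i 1) = 0)}"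
  have "two_sided_ideal ?J"
    by (auto simp: two_sided_ideal_def left_ideal_def lookup_minus lookup_mult_zero
        lookup_mult_single_one simp del: One_nat_def)
  moreover have "Poly_Mapping.lookup (mvar i :: ('k \<Rightarrow>\<^sub>0 nat) \<Rightarrow>\<^sub>0 'a) 0 = 0" for i :: 'k
    by (simp add: mvar_def lookup_single del: One_nat_def)
  then have "{mvar i * mvar j | i j. True} \<subseteq> ?J"
    by (auto simp: lookup_mult_zero lookup_mult_single_one simp del: One_nat_def)
  ultimately have "dual_ideal \<subseteq> ?J"
    unfolding dual_ideal_def by (intro hull_minimal) auto
  then show "p \<in> dual_ideal \<Longrightarrow>
    Poly_Mapping.lookup p 0 = 0 \<and> (\<forall>i. Poly_Mapping.lookup p (Poly_Mapping.single i 1) = 0)"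
    by blast
next
  note I = two_sided_idealD[OF dual_ideal]
  have mono: "Poly_Mapping.single m c \<in> dual_ideal"
    if nz: "m \<noteq> 0" and nv: "\<And>i. m \<noteq> Poly_Mapping.single i 1" for m :: "'k \<Rightarrow>\<^sub>0 nat" and c :: 'a
  proof -
    \<comment> \<open>Two variables, possibly equal, are split off one after the other.\<close>
    obtain i l where l: "m = Poly_Mapping.single i 1 + l"
      by (rule nonzero_monomial_cases[OF nz])
    then have "l \<noteq> 0" using nv[of i] by auto
    then obtain j l' where "l = Poly_Mapping.single j 1 + l'"
      by (rule nonzero_monomial_cases)
    with l have "Poly_Mapping.single m c = Poly_Mapping.single l' c * (mvar i * mvar j)"
      by (metis (no_types) mvar_def mult_single mult_1_right add.commute add.assoc)
    then show ?thesis by (simp add: I(5)[OF mvar_mult_mvar_in_dual_ideal])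
  qed
  assume p: "Poly_Mapping.lookup p 0 = 0 \<and> (\<forall>i. Poly_Mapping.lookup p (Poly_Mapping.single i 1) = 0)"
  have "(\<Sum>m\<in>A. Poly_Mapping.single m (Poly_Mapping.lookup p m)) \<in> dual_ideal"
    if "finite A" for A
    using that
  proof (induction A)
    case (insert m A)
    have "Poly_Mapping.single m (Poly_Mapping.lookup p m) \<in> dual_ideal"
    proof (cases "Poly_Mapping.lookup p m = 0")
      case False
      then show ?thesis using p by (intro mono) auto
    qed (simp add: I(1))
    with insert show ?case by (simp add: I(4))
  qed (simp add: I(1))
  moreover have "(\<Sum>m\<in>Poly_Mapping.keys p. Poly_Mapping.single m (Poly_Mapping.lookup p m)) = p"
    by (intro poly_mapping_eqI) (auto simp: lookup_sum lookup_single when_def in_keys_iff)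
  ultimately show "p \<in> dual_ideal" using finite_keys[of p] by (metis (no_types))
qed

section \<open>The coordinates and their product rules\<close>

lift_definition dual_re :: "('a::ring_1, 'k) dual \<Rightarrow> 'a" is "\<lambda>p. Poly_Mapping.lookup p 0"
  by (simp add: dual_ideal_iff lookup_minus)

lift_definition dual_im :: "'k \<Rightarrow> ('a::ring_1, 'k) dual \<Rightarrow> 'a"
  is "\<lambda>i p. Poly_Mapping.lookup p (Poly_Mapping.single i 1)"
  by (simp add: dual_ideal_iff lookup_minus)

lemma dual_eqI:
  assumes "dual_re x = dual_re y" and "\<And>i. dual_im i x = dual_im i y"
  shows "x = y"
  using assms by transfer (simp add: dual_ideal_iff lookup_minus)

lemma dual_re_simps [simp]:
  "dual_re 0 = 0" "dual_re 1 = 1" "dual_re (x + y) = dual_re x + dual_re y"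
  "dual_re (x * y) = dual_re x * dual_re y"
  "dual_re (dual_const a) = a" "dual_re (dual_beta i) = 0"
  by (transfer; simp add: lookup_add lookup_mult_zero mvar_def lookup_single del: One_nat_def)+

lemma dual_im_simps [simp]:
  "dual_im i 0 = 0" "dual_im i 1 = 0" "dual_im i (x + y) = dual_im i x + dual_im i y"
  "dual_im i (x * y) = dual_re x * dual_im i y + dual_im i x * dual_re y"
  "dual_im i (dual_const a) = 0"
  by (transfer; simp add: lookup_add lookup_mult_single_one lookup_one lookup_single_not_eq del: One_nat_def)+

lemma single_one_eq_iff:
  "Poly_Mapping.single i (1::nat) = Poly_Mapping.single j 1 \<longleftrightarrow> i = j"
  by (metis lookup_single_eq lookup_single_not_eq zero_neq_one)

lemma dual_im_beta [simp]: "dual_im i (dual_beta j) = (if i = j then 1 else 0)"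
  by transfer (auto simp: mvar_def lookup_single when_def single_one_eq_iff simp del: One_nat_def)

lemma dual_const_zero [simp]: "dual_const 0 = 0"
  by (rule dual_eqI) simp_all

lemma dual_re_sum: "dual_re (\<Sum>i\<in>A. h i) = (\<Sum>i\<in>A. dual_re (h i))"
  by (induction A rule: infinite_finite_induct) simp_all

lemma dual_im_sum: "dual_im i (\<Sum>j\<in>A. h j) = (\<Sum>j\<in>A. dual_im i (h j))"
  by (induction A rule: infinite_finite_induct) simp_all

lemma dual_re_power [simp]: "dual_re (x ^ j) = dual_re x ^ j"
  by (induction j) simp_all

text \<open>Iterating the Leibniz rule gives one summand for each position \<open>r\<close> of the
  factor that contributes its \<beta>-coordinate. The sum is the value of the assigned polynomial of
  the \<open>j\<close>-th power of the variable.\<close>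

lemma dual_im_power:
  "dual_im i (x ^ j) = (\<Sum>r = 1..j. dual_re x ^ (r - 1) * dual_im i x * dual_re x ^ (j - r))"
proof (induction j)
  case (Suc j)
  \<comment> \<open>For \<open>r \<le> j\<close> one factor \<open>dual_re x\<close> splits off on
    the right; the remaining index \<open>r = Suc j\<close> is the summand in which the last factor
    contributes.\<close>
  have "(\<Sum>r = 1..j. dual_re x ^ (r - 1) * dual_im i x * dual_re x ^ (Suc j - r)) =
    (\<Sum>r = 1..j. dual_re x ^ (r - 1) * dual_im i x * dual_re x ^ (j - r)) * dual_re x"
    by (auto simp: sum_distrib_right mult.assoc Suc_diff_le power_commutes intro!: sum.cong)
  then show ?case
    unfolding power_Suc2 dual_im_simps Suc.IH by (simp add: add.commute)
qed simp

section \<open>Evaluation\<close>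

lemma right_eval_single [simp]: "right_eval (Poly_Mapping.single n c) a = c * a ^ n"
  by (simp add: right_eval_def)

lemma right_eval_add [simp]: "right_eval (f + g) a = right_eval f a + right_eval g a"
  unfolding right_eval_def by (rule setsum_keys_plus_distrib) (simp_all add: distrib_right)

lemma assigned_eval_single [simp]:
  "assigned_eval (Poly_Mapping.single n c) a b = c * (\<Sum>r = 1..n. a ^ (r - 1) * b * a ^ (n - r))"
  by (simp add: assigned_eval_def sum_distrib_left mult.assoc)

lemma assigned_eval_add [simp]:
  "assigned_eval (f + g) a b = assigned_eval f a b + assigned_eval g a b"
  unfolding assigned_eval_def
  by (rule setsum_keys_plus_distrib) (simp_all add: distrib_right sum.distrib)

lemma assigned_eval_zero_right [simp]: "assigned_eval f a 0 = 0"
  by (simp add: assigned_eval_def)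

text \<open>Right substitution is not multiplicative in general. Here the power of the variable
  moves past the coefficients of \<open>g\<close>, so \<open>a ^ n\<close> ends up to the right of
  the whole value of \<open>g\<close>.\<close>

lemma right_eval_single_mult:
  "right_eval (Poly_Mapping.single n c * g) a = c * right_eval g a * a ^ n"
proof (induction g rule: poly_mapping_add_induct)
  case (single m d)
  show ?case by (simp add: mult_single mult.assoc add.commute[of n] flip: power_add)
qed (simp add: distrib_left distrib_right)

lemma right_eval_mult_eq_zero:
  assumes "right_eval g a = 0"
  shows "right_eval (f * g) a = 0"
  by (induction f rule: poly_mapping_add_induct)
    (simp_all add: right_eval_single_mult assms distrib_right)

lemma right_eval_diff: "right_eval (f - g) a = right_eval f a - right_eval g a"
  by (metis add_diff_cancel diff_add_cancel right_eval_add)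

lemma left_ideal_null_polys: "left_ideal null_polys"
  unfolding left_ideal_def null_polys_def
  by (auto simp: right_eval_mult_eq_zero right_eval_diff) (simp add: right_eval_def)

section \<open>Polynomials over the dual numbers\<close>

text \<open>With \<open>poly_im\<close>, this reads off the components f_0 and f_i of f = f_0 + sum
  f_i \<beta>_i.\<close>

definition poly_re :: "(nat \<Rightarrow>\<^sub>0 ('a::ring_1, 'k) dual) \<Rightarrow> nat \<Rightarrow>\<^sub>0 'a" where
  "poly_re = Poly_Mapping.map dual_re"

definition poly_im :: "'k \<Rightarrow> (nat \<Rightarrow>\<^sub>0 ('a::ring_1, 'k) dual) \<Rightarrow> nat \<Rightarrow>\<^sub>0 'a" where
  "poly_im i = Poly_Mapping.map (dual_im i)"

lemma lookup_poly_re: "Poly_Mapping.lookup (poly_re f) n = dual_re (Poly_Mapping.lookup f n)"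
  by (simp add: poly_re_def lookup_map)

lemma lookup_poly_im: "Poly_Mapping.lookup (poly_im i f) n = dual_im i (Poly_Mapping.lookup f n)"
  by (simp add: poly_im_def lookup_map)

lemma lookup_dual_poly: "Poly_Mapping.lookup (dual_poly f) n = dual_const (Poly_Mapping.lookup f n)"
  by (simp add: dual_poly_def lookup_map)

lemma poly_re_single [simp]: "poly_re (Poly_Mapping.single n c) = Poly_Mapping.single n (dual_re c)"
  by (simp add: poly_re_def)

lemma poly_im_single [simp]: "poly_im i (Poly_Mapping.single n c) = Poly_Mapping.single n (dual_im i c)"
  by (simp add: poly_im_def)

lemma poly_re_add [simp]: "poly_re (f + g) = poly_re f + poly_re g"
  by (simp add: poly_re_def map_add_additive)

lemma poly_im_add [simp]: "poly_im i (f + g) = poly_im i f + poly_im i g"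
  by (simp add: poly_im_def map_add_additive)

lemma dual_poly_eqI:
  assumes "poly_re f = poly_re g" and "\<And>i. poly_im i f = poly_im i g"
  shows "f = g"
  using assms by (metis dual_eqI lookup_poly_im lookup_poly_re poly_mapping_eqI)

lemma poly_re_sum: "poly_re (\<Sum>i\<in>A. h i) = (\<Sum>i\<in>A. poly_re (h i))"
  by (intro poly_mapping_eqI) (simp add: lookup_poly_re lookup_sum dual_re_sum)

lemma poly_im_sum: "poly_im i (\<Sum>j\<in>A. h j) = (\<Sum>j\<in>A. poly_im i (h j))"
  by (intro poly_mapping_eqI) (simp add: lookup_poly_im lookup_sum dual_im_sum)

lemma poly_re_mult [simp]: "poly_re (f * g) = poly_re f * poly_re g"
proof (induction f rule: poly_mapping_add_induct)
  case (single n c)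
  show ?case
    by (induction g rule: poly_mapping_add_induct) (simp_all add: mult_single distrib_left)
qed (simp add: distrib_right)

text \<open>The variable commutes with the coefficients, so on monomials this is the Leibniz rule
  for \<open>dual_im\<close>.\<close>

lemma poly_im_mult [simp]: "poly_im i (f * g) = poly_re f * poly_im i g + poly_im i f * poly_re g"
proof (induction f rule: poly_mapping_add_induct)
  case (single n c)
  show ?case
    by (induction g rule: poly_mapping_add_induct)
      (simp_all add: mult_single distrib_left single_add add.assoc add.left_commute)
qed (simp add: distrib_right add.assoc add.left_commute)

lemma poly_re_dual_poly [simp]: "poly_re (dual_poly f) = f"
  by (intro poly_mapping_eqI) (simp add: lookup_poly_re lookup_dual_poly)

lemma poly_im_dual_poly [simp]: "poly_im i (dual_poly f) = 0"
  by (intro poly_mapping_eqI) (simp add: lookup_poly_im lookup_dual_poly)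

lemma poly_re_beta_poly [simp]: "poly_re (beta_poly i) = 0"
  by (simp add: beta_poly_def)

lemma poly_im_beta_poly [simp]: "poly_im i (beta_poly j) = (if i = j then 1 else 0)"
  by (simp add: beta_poly_def)

text \<open>This and the next identity give uniqueness of the components; with
  \<open>dual_poly_eqI\<close> they also give existence.\<close>

lemma poly_re_decomposition:
  "poly_re (dual_poly f + (\<Sum>i\<in>UNIV. dual_poly (g i) * beta_poly (i::'k::finite))) = f"
  by (simp add: poly_re_sum)

lemma poly_im_decomposition:
  "poly_im i (dual_poly f + (\<Sum>i\<in>UNIV. dual_poly (g i) * beta_poly (i::'k::finite))) = g i"
  by (simp add: poly_im_sum if_distrib[where f = "(*) _"] cong: if_cong)

section \<open>Values and null polynomials over the dual numbers\<close>

lemma dual_re_right_eval: "dual_re (right_eval f x) = right_eval (poly_re f) (dual_re x)"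
  by (induction f rule: poly_mapping_add_induct) simp_all

text \<open>By the Leibniz rule on a monomial, the \<beta>-coordinate comes either from the power of
  \<open>x\<close>, which gives the assigned polynomial, or from the coefficient.\<close>

lemma dual_im_right_eval:
  "dual_im i (right_eval f x) =
    assigned_eval (poly_re f) (dual_re x) (dual_im i x) + right_eval (poly_im i f) (dual_re x)"
  by (induction f rule: poly_mapping_add_induct)
    (simp_all add: dual_im_power add.assoc add.left_commute)

lemma null_polys_dual_iff:
  fixes f :: "nat \<Rightarrow>\<^sub>0 ('a::ring_1, 'k) dual"
  shows "f \<in> null_polys \<longleftrightarrow> poly_re f \<in> assigned_null_polys \<and> (\<forall>i. poly_im i f \<in> null_polys)"
proof
  assume f: "f \<in> null_polys"
  have re: "right_eval (poly_re f) a = 0" for a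
    using f dual_re_right_eval[of f "dual_const a"] by (simp add: null_polys_def)
  \<comment> \<open>At a constant the \<beta>-coordinate of the argument is 0, so the assigned term
    drops out.\<close>
  have im: "right_eval (poly_im i f) a = 0" for i a
    using f dual_im_right_eval[of i f "dual_const a"] by (simp add: null_polys_def)
  have "assigned_eval (poly_re f) a b = 0" for a b
    \<comment> \<open>The argument has coordinates \<open>a\<close> and \<open>b\<close> at an
      arbitrary index, and by \<open>im\<close> only the assigned term survives.\<close>
    using f dual_im_right_eval[of i f "dual_const a + dual_const b * dual_beta i" for i]
    by (simp add: null_polys_def im)
  with re im show "poly_re f \<in> assigned_null_polys \<and> (\<forall>i. poly_im i f \<in> null_polys)"
    by (simp add: assigned_null_polys_def null_polys_def)
next
  assume *: "poly_re f \<in> assigned_null_polys \<and> (\<forall>i. poly_im i f \<in> null_polys)"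
  have "right_eval f x = 0" for x
    using * by (intro dual_eqI)
      (simp_all add: dual_re_right_eval dual_im_right_eval assigned_null_polys_def null_polys_def)
  then show "f \<in> null_polys" by (simp add: null_polys_def)
qed

lemma null_polys_dual_eq:
  "(null_polys :: (nat \<Rightarrow>\<^sub>0 ('a::ring_1, 'k::finite) dual) set) =
    {dual_poly f + (\<Sum>i\<in>UNIV. dual_poly (g i) * beta_poly i) | f g.
      f \<in> assigned_null_polys \<and> (\<forall>i. g i \<in> null_polys)}" (is "_ = ?D")
proof (intro equalityI subsetI)
  fix h :: "nat \<Rightarrow>\<^sub>0 ('a, 'k) dual"
  assume "h \<in> null_polys"
  moreover have "h = dual_poly (poly_re h) + (\<Sum>i\<in>UNIV. dual_poly (poly_im i h) * beta_poly i)"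
    by (rule dual_poly_eqI) (simp_all only: poly_re_decomposition poly_im_decomposition)
  ultimately show "h \<in> ?D"
    unfolding null_polys_dual_iff mem_Collect_eq
    by (intro exI[of _ "poly_re h"] exI[of _ "\<lambda>i. poly_im i h"]) simp
next
  fix h :: "nat \<Rightarrow>\<^sub>0 ('a, 'k) dual"
  assume "h \<in> ?D"
  then obtain f g where h: "h = dual_poly f + (\<Sum>i\<in>UNIV. dual_poly (g i) * beta_poly i)"
    and fg: "f \<in> assigned_null_polys" "\<And>i. g i \<in> null_polys"
    by blast
  show "h \<in> null_polys"
    unfolding null_polys_dual_iff h poly_re_decomposition poly_im_decomposition
    using fg by simp
qed

section \<open>Left and two-sided ideals of null polynomials\<close>

lemma zero_in_null_polys [simp]: "0 \<in> null_polys"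
  by (rule left_ideal_null_polys[unfolded left_ideal_def, THEN conjunct1])

lemma dual_poly_in_null_polys_iff:
  "dual_poly f \<in> (null_polys :: (nat \<Rightarrow>\<^sub>0 ('a::ring_1, 'k) dual) set) \<longleftrightarrow> f \<in> assigned_null_polys"
  by (simp add: null_polys_dual_iff)

text \<open>\<open>dual_poly\<close> is a ring homomorphism, and the set is the preimage under it of
  the left ideal of null polynomials over the dual numbers in one variable.\<close>

lemma left_ideal_assigned_null_polys:
  "left_ideal (assigned_null_polys :: (nat \<Rightarrow>\<^sub>0 'a::ring_1) set)"
proof -
  let ?N = "null_polys :: (nat \<Rightarrow>\<^sub>0 ('a, unit) dual) set"
  have mult: "dual_poly (f * g) = (dual_poly f * dual_poly g :: nat \<Rightarrow>\<^sub>0 ('a, unit) dual)"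
    for f g :: "nat \<Rightarrow>\<^sub>0 'a"
    by (rule dual_poly_eqI) simp_all
  have add: "dual_poly (f + g) = (dual_poly f + dual_poly g :: nat \<Rightarrow>\<^sub>0 ('a, unit) dual)"
    for f g :: "nat \<Rightarrow>\<^sub>0 'a"
    by (rule dual_poly_eqI) simp_all
  have diff: "dual_poly (f - g) = (dual_poly f - dual_poly g :: nat \<Rightarrow>\<^sub>0 ('a, unit) dual)"
    for f g :: "nat \<Rightarrow>\<^sub>0 'a"
    by (metis add add_diff_cancel diff_add_cancel)
  have "dual_poly 0 = (0 :: nat \<Rightarrow>\<^sub>0 ('a, unit) dual)"
    by (metis diff diff_self)
  with left_ideal_null_polys[where 'a = "('a, unit) dual"] show ?thesis
    unfolding left_ideal_def Ball_def dual_poly_in_null_polys_iff[where 'k = unit, symmetric]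
    by (simp add: mult diff)
qed

text \<open>All three sets are left ideals, so only right multiplication has to be compared,
  component by component.\<close>

lemma two_sided_ideal_null_polys_dual_iff:
  "two_sided_ideal (null_polys :: (nat \<Rightarrow>\<^sub>0 ('a::ring_1, 'k) dual) set) \<longleftrightarrow>
    two_sided_ideal (assigned_null_polys :: (nat \<Rightarrow>\<^sub>0 'a) set) \<and>
    two_sided_ideal (null_polys :: (nat \<Rightarrow>\<^sub>0 'a) set)" (is "?D \<longleftrightarrow> ?A \<and> ?N")
proof
  assume ?D
  note D = two_sided_idealD(6)[OF this]
  have "f * g \<in> assigned_null_polys" if "f \<in> assigned_null_polys" for f g :: "nat \<Rightarrow>\<^sub>0 'a"
    using D[of "dual_poly f" "dual_poly g"] that by (simp add: null_polys_dual_iff)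
  moreover have "f * g \<in> null_polys" if "f \<in> null_polys" for f g :: "nat \<Rightarrow>\<^sub>0 'a"
  proof -
    fix i :: 'k
    have "0 \<in> (assigned_null_polys :: (nat \<Rightarrow>\<^sub>0 'a) set)"
      by (rule left_ideal_assigned_null_polys[unfolded left_ideal_def, THEN conjunct1])
    \<comment> \<open>Multiplying by \<beta>_i moves \<open>f\<close> into a component where being
      null on the base ring suffices; after right multiplication by \<open>g\<close> that component
      is \<open>f * g\<close>.\<close>
    then have "dual_poly f * beta_poly i \<in> null_polys"
      using that by (simp add: null_polys_dual_iff)
    then have "poly_im i (dual_poly f * beta_poly i * dual_poly g) \<in> null_polys"
      using D null_polys_dual_iff by blast
    then show "f * g \<in> null_polys" by simp
  qed
  ultimately show "?A \<and> ?N"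
    using left_ideal_null_polys left_ideal_assigned_null_polys
    by (auto simp: two_sided_ideal_def)
next
  assume AN: "?A \<and> ?N"
  note A = two_sided_idealD[OF conjunct1[OF AN]] and N = two_sided_idealD[OF conjunct2[OF AN]]
  have "f * g \<in> null_polys" if f: "f \<in> null_polys" for f g :: "nat \<Rightarrow>\<^sub>0 ('a, 'k) dual"
  proof -
    have "poly_re f \<in> assigned_null_polys" "poly_re f \<in> null_polys" "\<And>i. poly_im i f \<in> null_polys"
      using f by (auto simp: null_polys_dual_iff assigned_null_polys_def)
    \<comment> \<open>The \<beta>-components of the product are f_0 g_i + f_i g_0. Both summands are
      null, the first because f_0 itself is null.\<close>
    then show ?thesis
      by (simp add: null_polys_dual_iff A(6) N(4) N(6))
  qed
  then show ?D
    using left_ideal_null_polys by (auto simp: two_sided_ideal_def)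
qed

theorem theorem4p4:
  assumes noncommutative: "\<exists>a b :: 'a::{ring_1, finite}. a * b \<noteq> b * a"
  shows "(null_polys :: (nat \<Rightarrow>\<^sub>0 ('a, 'k::finite) dual) set) =
           {dual_poly f + (\<Sum>i\<in>UNIV. dual_poly (g i) * beta_poly i) | f g.
              f \<in> assigned_null_polys \<and> (\<forall>i. g i \<in> null_polys)} \<and>
         (two_sided_ideal (null_polys :: (nat \<Rightarrow>\<^sub>0 ('a, 'k) dual) set) \<longleftrightarrow>
           two_sided_ideal (assigned_null_polys :: (nat \<Rightarrow>\<^sub>0 'a) set) \<and>
           two_sided_ideal (null_polys :: (nat \<Rightarrow>\<^sub>0 'a) set))"
  using null_polys_dual_eq two_sided_ideal_null_polys_dual_iff by (rule conjI)

end
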